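(* Let $P$ be a finite poset with $\hat 0$ and $\hat 1$, let $F_1,\dots,F_N$ be a lexicographic order on the facets of the order complex $\Delta(P)$, and consider the matching $M=\bigcup_k M_k$ on the faces of $\Delta(P)$ described in the context. If $F_k$ contributes a critical cell (i.e. some face $\sigma\in F_k\setminus\bigcup_{i<k}F_i$ is unmatched), then the dimension of this critical cell is one less than the number of intervals in $J(F_k)$, that is, $\dim\sigma=|J(F_k)|-1$.
   Context: Order complex and facets. $\Delta(P)$ is the simplicial complex whose faces are the chains (including the empty chain, of dimension $-1$) of $P\setminus\{\hat 0,\hat 1\}$. Its facets correspond to the saturated chains $\hat 0=u_0\prec u_1\prec\cdots\prec u_s=\hat 1$ of $P$ ($\prec$ denotes a covering relation); the facet has vertices $u_1,\dots,u_{s-1}$, and the rank of $u_i$ within that facet is $i$. $P$ is not assumed graded. A facet is also identified with the set of all its faces, so $F_k\setminus\bigcup_{i<k}F_i$ is the set of faces contained in $F_k$ but in no $F_i$ with $i<k$, and $F_k\cap\bigcup_{i<k}F_i$ is the complex of faces of $F_k$ lying in some earlier facet. Lexicographic order. A total order on the facets of $\Delta(P)$ such that: whenever facets $F,F'$ have the same elements at ranks $1,\dots,i$ (for some $i\ge 0$) but different elements at rank $i+1$, and $F$ precedes $F'$, then every facet containing the elements of $F$ at ranks $1,\dots,i+1$ precedes every facet containing the elements of $F'$ at ranks $1,\dots,i+1$. Interval systems. For a lexicographic order, each inclusion-maximal face of $F_k\cap\bigcup_{i<k}F_i$ is obtained from $F_k$ by deleting the vertices in a nonempty set of consecutive ranks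 of $F_k$. These deleted sets are the minimal skipped intervals of $F_k$; $I(F_k)$ is the set of them ($I(F_1)=\emptyset$). The set $J(F_k)$ of pairwise disjoint intervals is obtained from $I:=I(F_k)$, starting with $J=\emptyset$, by repeating the following until $I=\emptyset$: (1) add to $J$ the interval of $I$ whose lowest element has smallest rank; (2) remove this interval from $I$ and replace every other interval of $I$ by its intersection with the set of ranks strictly above all ranks of the interval just added; (3) delete from $I$ every interval that properly contains another interval of $I$. Write $J(F_k)=\{j_1,\dots,j_r\}$ in increasing order of rank, and let $\rho_i$ be the lowest-rank element of $j_i$. The matching pairs $M_k$ (on the faces of $F_k\setminus\bigcup_{i<k}F_i$). (i) If some vertex of $F_k$ lies in no interval of $I(F_k)$, let $\rho_0$ be the lowest-rank such vertex; $M_k$ consists of the pairs $\{h\setminus\{\rho_0\},h\}$ for all faces $h\in F_k\setminus\bigcup_{i<k}F_i$ with $\rho_0\in h$. (ii) Otherwise, for a face $h\in F_k\setminus\bigcup_{i<k}F_i$ let $\tau(h)=\min\{i: 1\le i\le r,\ h\cap j_i\ne\{\rho_i\}\}$, with $\tau(h)=\infty$ if this set is empty. If $\tau(h)<\infty$, pair $h$ with $h\setminus\{\rho_{\tau(h)}\}$ if $\rho_{\tau(h)}\in h$ and with $h\cup\{\rho_{\tau(h)}\}$ otherwise. If $\tau(h)=\infty$ and some vertex of $F_k$ lies in no interval of $J(F_k)$, let $\rho_{r+1}$ be the lowest-rank such vertex, and pair $h$ with $h\setminus\{\rho_{r+1}\}$ if $\rho_{r+1}\in h$ and with $h\cup\{\rho_{r+1}\}$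 otherwise. If $\tau(h)=\infty$ and every vertex of $F_k$ lies in some interval of $J(F_k)$, then $h$ is left unpaired. Critical cells are the faces of $\Delta(P)$ (possibly the empty face) that are unmatched in $M$. *)

theory Defs
  imports Main "HOL-Library.Extended_Nat"
begin

text \<open>
  The finite poset \<open>P\<close> with least and greatest element is a type of sort
  \<open>{finite, order_bot, order_top}\<close>. Faces and facets are sets of elements of this type.
\<close>

definition order_complex :: "'a::{order_bot, order_top} set set" where
  "order_complex = {A. A \<subseteq> - {bot, top} \<and> Complete_Partial_Order.chain (\<le>) A}"

definition face_dim :: "'a set \<Rightarrow> int" where
  "face_dim A = int (card A) - 1"

definition facets :: "'a::{order_bot, order_top} set set" where
  "facets = {C \<in> order_complex. \<not> (\<exists>A \<in> order_complex. C \<subset> A)}"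

text \<open>
  A facet \<open>C\<close> consists of the vertices \<open>u\<^sub>1 < \<dots> < u\<^sub>s\<^sub>-\<^sub>1\<close> of a saturated chain;
  \<open>rank_in C u\<^sub>i\<close> is \<open>i\<close>, so ranks start at 1 and depend on the facet.
\<close>

definition rank_in :: "'a::order set \<Rightarrow> 'a \<Rightarrow> nat" where
  "rank_in C v = card {u \<in> C. u \<le> v}"

definition upto_rank :: "'a::order set \<Rightarrow> nat \<Rightarrow> 'a set" where
  "upto_rank C i = {v \<in> C. rank_in C v \<le> i}"

text \<open>
  The facets are enumerated as \<open>F 1, \<dots>, F N\<close>; values of \<open>F\<close> at other indices are irrelevant.
\<close>

definition lexicographic_order :: "(nat \<Rightarrow> 'a::{order_bot, order_top} set) \<Rightarrow> nat \<Rightarrow> bool" where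
  "lexicographic_order F N \<longleftrightarrow>
     bij_betw F {1..N} facets \<and>
     (\<forall>k\<in>{1..N}. \<forall>l\<in>{1..N}. \<forall>i.
        k < l \<and> upto_rank (F k) i = upto_rank (F l) i \<and>
        (\<exists>x\<in>F k. \<exists>y\<in>F l. rank_in (F k) x = i + 1 \<and> rank_in (F l) y = i + 1 \<and> x \<noteq> y) \<longrightarrow>
        (\<forall>m\<in>{1..N}. \<forall>n\<in>{1..N}.
           upto_rank (F k) (i + 1) \<subseteq> F m \<and> upto_rank (F l) (i + 1) \<subseteq> F n \<longrightarrow> m < n))"

definition new_faces :: "(nat \<Rightarrow> 'a set) \<Rightarrow> nat \<Rightarrow> 'a set set" where
  "new_faces F k = {h. h \<subseteq> F k \<and> (\<forall>i\<in>{1..<k}. \<not> h \<subseteq> F i)}"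

definition old_faces :: "(nat \<Rightarrow> 'a set) \<Rightarrow> nat \<Rightarrow> 'a set set" where
  "old_faces F k = {h. h \<subseteq> F k \<and> (\<exists>i\<in>{1..<k}. h \<subseteq> F i)}"

text \<open>
  Intervals of ranks of a facet are represented by the sets of vertices at these ranks.
\<close>

definition skipped_intervals :: "(nat \<Rightarrow> 'a set) \<Rightarrow> nat \<Rightarrow> 'a set set" where
  "skipped_intervals F k =
     {F k - g | g. g \<in> old_faces F k \<and> \<not> (\<exists>g' \<in> old_faces F k. g \<subset> g')}"

definition lowest :: "'a::order set \<Rightarrow> 'a set \<Rightarrow> 'a" where
  "lowest C A = (ARG_MIN (rank_in C) v. v \<in> A)"

definition lowest_rank :: "'a::order set \<Rightarrow> 'a set \<Rightarrow> nat" where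
  "lowest_rank C A = rank_in C (lowest C A)"

definition first_interval :: "'a::order set \<Rightarrow> 'a set set \<Rightarrow> 'a set" where
  "first_interval C I = (ARG_MIN (lowest_rank C) j. j \<in> I)"

definition truncate_above :: "'a::order set \<Rightarrow> 'a set \<Rightarrow> 'a set \<Rightarrow> 'a set" where
  "truncate_above C j A = {v \<in> A. \<forall>u\<in>j. rank_in C u < rank_in C v}"

definition minimal_sets :: "'a set set \<Rightarrow> 'a set set" where
  "minimal_sets I = {A \<in> I. \<not> (\<exists>B \<in> I. B \<subset> A)}"

function disjoint_intervals :: "'a::{finite, order} set \<Rightarrow> 'a set set \<Rightarrow> 'a set set" where
  "disjoint_intervals C I =
     (if I = {} then {}
      else let j = first_interval C I in
        insert j (disjoint_intervals C (minimal_sets (truncate_above C j ` (I - {j})))))"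
  by auto
termination
proof (relation "measure (\<lambda>(C, I). card I)")
  fix C :: "'a set" and I j
  assume "I \<noteq> {}" and j: "j = first_interval C I"
  then obtain i where "i \<in> I" by auto
  then have "j \<in> I"
    unfolding j first_interval_def by (rule arg_min_natI)
  have "card (minimal_sets (truncate_above C j ` (I - {j}))) \<le> card (truncate_above C j ` (I - {j}))"
    by (rule card_mono) (auto simp: minimal_sets_def)
  also have "\<dots> \<le> card (I - {j})"
    by (rule card_image_le) simp
  also have "\<dots> < card I"
    using \<open>j \<in> I\<close> by (intro psubset_card_mono) auto
  finally show "((C, minimal_sets (truncate_above C j ` (I - {j}))), (C, I))
      \<in> measure (\<lambda>(C, I). card I)"
    by simp
qed simp

declare disjoint_intervals.simps [simp del]

definition J_intervals :: "(nat \<Rightarrow> 'a::{finite, order} set) \<Rightarrow> nat \<Rightarrow> 'a set set" where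
  "J_intervals F k = disjoint_intervals (F k) (skipped_intervals F k)"

text \<open>
  \<open>J_nth F k i\<close> and \<open>rho F k i\<close> are \<open>j\<^sub>i\<close> and its lowest vertex, for \<open>1 \<le> i \<le> card (J_intervals F k)\<close>.
\<close>

definition J_nth :: "(nat \<Rightarrow> 'a::{finite, order} set) \<Rightarrow> nat \<Rightarrow> nat \<Rightarrow> 'a set" where
  "J_nth F k i = sorted_key_list_of_set (lowest_rank (F k)) (J_intervals F k) ! (i - 1)"

definition rho :: "(nat \<Rightarrow> 'a::{finite, order} set) \<Rightarrow> nat \<Rightarrow> nat \<Rightarrow> 'a" where
  "rho F k i = lowest (F k) (J_nth F k i)"

definition tau :: "(nat \<Rightarrow> 'a::{finite, order} set) \<Rightarrow> nat \<Rightarrow> 'a set \<Rightarrow> enat" where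
  "tau F k h =
     (let T = {i \<in> {1..card (J_intervals F k)}. h \<inter> J_nth F k i \<noteq> {rho F k i}}
      in if T = {} then \<infinity> else enat (Min T))"

definition toggle :: "'a \<Rightarrow> 'a set \<Rightarrow> 'a set" where
  "toggle v h = (if v \<in> h then h - {v} else insert v h)"

text \<open>A matching is a set of unordered pairs \<open>{h, h'}\<close> of faces.\<close>

definition matching_at :: "(nat \<Rightarrow> 'a::{finite, order} set) \<Rightarrow> nat \<Rightarrow> 'a set set set" where
  "matching_at F k =
     (let U = F k - \<Union> (skipped_intervals F k);
          V = F k - \<Union> (J_intervals F k)
      in if U \<noteq> {} then
           {{h - {lowest (F k) U}, h} | h. h \<in> new_faces F k \<and> lowest (F k) U \<in> h}
         else
           {{h, toggle (rho F k i) h} | h i. h \<in> new_faces F k \<and> tau F k h = enat i} \<union>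
           {{h, toggle (lowest (F k) V) h} | h. h \<in> new_faces F k \<and> tau F k h = \<infinity> \<and> V \<noteq> {}})"

definition matching :: "(nat \<Rightarrow> 'a::{finite, order} set) \<Rightarrow> nat \<Rightarrow> 'a set set set" where
  "matching F N = (\<Union>k\<in>{1..N}. matching_at F k)"

definition critical_cell ::
    "(nat \<Rightarrow> 'a::{finite, order_bot, order_top} set) \<Rightarrow> nat \<Rightarrow> 'a set \<Rightarrow> bool" where
  "critical_cell F N h \<longleftrightarrow> h \<in> order_complex \<and> h \<notin> \<Union> (matching F N)"

end

theory Submission
  imports Defs
begin

text \<open>
  An unmatched new face \<open>\<sigma>\<close> of \<open>F\<^sub>k\<close> meets every interval of \<open>J(F\<^sub>k)\<close> exactly in its lowest vertex,
  and these intervals cover \<open>F\<^sub>k\<close>; since they are nonempty and pairwise disjoint, \<open>\<sigma>\<close> has one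
  vertex for each of them. Nonemptiness is the point where the lexicographic order enters: minimal skipped
  sets are convex in \<open>F\<^sub>k\<close>, because a facet preceding \<open>F\<^sub>k\<close> can be spliced with \<open>F\<^sub>k\<close> at a common
  vertex without losing precedence, and a truncation step applied to an antichain of convex sets
  never produces the empty set.
\<close>

section \<open>Ranks in a chain and lowest elements\<close>

lemma rank_in_strict_mono:
  fixes C :: "'a::{finite, order} set"
  assumes "v \<in> C" "u < v"
  shows "rank_in C u < rank_in C v"
proof -
  have "{w \<in> C. w \<le> u} \<subseteq> {w \<in> C. w \<le> v}" using assms(2) by (auto intro: order.trans)
  moreover have "v \<in> {w \<in> C. w \<le> v} - {w \<in> C. w \<le> u}" using assms by auto
  ultimately have "{w \<in> C. w \<le> u} \<subset> {w \<in> C. w \<le> v}" by blast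
  then show ?thesis unfolding rank_in_def by (intro psubset_card_mono) simp_all
qed

lemma rank_in_less_iff:
  fixes C :: "'a::{finite, order} set"
  assumes "Complete_Partial_Order.chain (\<le>) C" "u \<in> C" "v \<in> C"
  shows "rank_in C u < rank_in C v \<longleftrightarrow> u < v"
  using assms rank_in_strict_mono[of _ C] chainD[OF assms]
  by (metis order_less_asym order_le_less)

lemma rank_in_le_iff:
  fixes C :: "'a::{finite, order} set"
  assumes "Complete_Partial_Order.chain (\<le>) C" "u \<in> C" "v \<in> C"
  shows "rank_in C u \<le> rank_in C v \<longleftrightarrow> u \<le> v"
  using rank_in_less_iff[OF assms(1) assms(3,2)] chainD[OF assms]
  by (metis linorder_not_less order_le_less order_less_asym)

lemma inj_on_rank_in:
  fixes C :: "'a::{finite, order} set"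
  assumes "Complete_Partial_Order.chain (\<le>) C"
  shows "inj_on (rank_in C) C"
  by (rule inj_onI) (metis assms order.antisym order.refl rank_in_le_iff)

lemma rank_in_image:
  fixes C :: "'a::{finite, order} set"
  assumes "Complete_Partial_Order.chain (\<le>) C"
  shows "rank_in C ` C = {1..card C}"
proof (rule card_subset_eq)
  have "rank_in C v \<in> {1..card C}" if "v \<in> C" for v
  proof -
    have "{u \<in> C. u \<le> v} \<noteq> {}" using that by auto
    then have "0 < rank_in C v" by (simp add: rank_in_def card_gt_0_iff)
    moreover have "rank_in C v \<le> card C"
      unfolding rank_in_def by (rule card_mono) auto
    ultimately show ?thesis by simp
  qed
  then show "rank_in C ` C \<subseteq> {1..card C}" by blast
  show "card (rank_in C ` C) = card {1..card C}"
    using card_image[OF inj_on_rank_in[OF assms]] by simp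
qed simp

lemma lowest_in:
  assumes "A \<noteq> {}"
  shows "lowest C A \<in> A"
  unfolding lowest_def using assms by (metis all_not_in_conv arg_min_natI)

lemma lowest_rank_le: "v \<in> A \<Longrightarrow> lowest_rank C A \<le> rank_in C v"
  unfolding lowest_rank_def lowest_def by (rule arg_min_nat_le)

lemma first_interval_in:
  assumes "I \<noteq> {}"
  shows "first_interval C I \<in> I"
  unfolding first_interval_def using assms by (metis all_not_in_conv arg_min_natI)

lemma lowest_rank_first_interval_le:
  "A \<in> I \<Longrightarrow> lowest_rank C (first_interval C I) \<le> lowest_rank C A"
  unfolding first_interval_def by (rule arg_min_nat_le)

section \<open>Facets as maximal chains: splicing and first differences\<close>

lemma facetsD:
  assumes "C \<in> facets"
  shows "C \<subseteq> - {bot, top}" "Complete_Partial_Order.chain (\<le>) C"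
  using assms by (auto simp: facets_def order_complex_def)

text \<open>Otherwise \<open>insert p C\<close> would be a strictly larger chain in the order
  complex. Maximality enters the splicing argument in this form.\<close>

lemma facets_memI:
  assumes "C \<in> facets" "p \<noteq> bot" "p \<noteq> top" "\<And>z. z \<in> C \<Longrightarrow> z \<le> p \<or> p \<le> z"
  shows "p \<in> C"
proof (rule ccontr)
  assume "p \<notin> C"
  moreover have "insert p C \<in> order_complex"
    using assms facetsD[OF assms(1)]
    unfolding order_complex_def chain_def by auto
  ultimately show False using assms(1) unfolding facets_def by blast
qed

lemma facets_subset_eq:
  assumes "C \<in> facets" "D \<in> facets" "C \<subseteq> D"
  shows "C = D"
  using assms unfolding facets_def by blast

text \<open>Only maximality needs work. An element \<open>p\<close> comparable with the whole
  spliced set lies above or below \<open>w\<close>. If above, it is comparable through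
  \<open>w\<close> also with the part of \<open>D\<close> below \<open>w\<close>, so it belongs to
  the maximal chain \<open>D\<close>; the other case is symmetric with \<open>C\<close>.\<close>

lemma facets_splice:
  assumes C: "C \<in> facets" and D: "D \<in> facets" and w: "w \<in> C" "w \<in> D"
  shows "{z \<in> C. z \<le> w} \<union> {z \<in> D. w \<le> z} \<in> facets" (is "?E \<in> _")
proof -
  note chains = facetsD(2)[OF C] facetsD(2)[OF D]
  have E: "?E \<in> order_complex"
    using facetsD(1)[OF C] facetsD(1)[OF D] chains
    unfolding order_complex_def chain_def by (auto intro: order.trans)
  have "A \<subseteq> ?E" if A: "A \<in> order_complex" "?E \<subseteq> A" for A
  proof
    fix p assume p: "p \<in> A"
    have ne: "p \<noteq> bot" "p \<noteq> top" and cmp: "\<And>z. z \<in> A \<Longrightarrow> z \<le> p \<or> p \<le> z"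
      using A(1) p unfolding order_complex_def chain_def by auto
    from w A(2) have "w \<in> A" by auto
    from cmp[OF this] show "p \<in> ?E"
    proof
      assume le: "w \<le> p"
      have "z \<le> p \<or> p \<le> z" if "z \<in> D" for z
      proof (cases "w \<le> z")
        case True
        then show ?thesis using cmp A(2) that by auto
      next
        case False
        then have "z \<le> w" using chainD[OF chains(2) that w(2)] by auto
        then show ?thesis using le by (auto intro: order.trans)
      qed
      from facets_memI[OF D ne this] show ?thesis using le by auto
    next
      assume le: "p \<le> w"
      have "z \<le> p \<or> p \<le> z" if "z \<in> C" for z
      proof (cases "z \<le> w")
        case True
        then show ?thesis using cmp A(2) that by auto
      next
        case False
        then have "w \<le> z" using chainD[OF chains(1) that w(1)] by auto
        then show ?thesis using le by (auto intro: order.trans)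
      qed
      from facets_memI[OF C ne this] show ?thesis using le by auto
    qed
  qed
  with E show ?thesis unfolding facets_def by blast
qed

text \<open>This supplies the premises of the condition in \<open>lexicographic_order\<close>. A
  facet is never a proper part of another, so neither chain can run out of vertices before the two
  disagree.\<close>

lemma facets_first_difference:
  fixes C D :: "'a::{finite, order_bot, order_top} set"
  assumes C: "C \<in> facets" and D: "D \<in> facets" and "C \<noteq> D"
  obtains a x y where "upto_rank C a = upto_rank D a"
    "x \<in> C" "y \<in> D" "rank_in C x = a + 1" "rank_in D y = a + 1" "x \<noteq> y"
proof -
  note chains = facetsD(2)[OF C] facetsD(2)[OF D]
  have all: "upto_rank E n = E" if chE: "Complete_Partial_Order.chain (\<le>) E" and "card E \<le> n"
    for E :: "'a set" and n
  proof -
    have "rank_in E v \<le> n" if "v \<in> E" for v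
      using imageI[OF that, of "rank_in E"] rank_in_image[OF chE] \<open>card E \<le> n\<close> by auto
    then show ?thesis unfolding upto_rank_def by blast
  qed
  have zero: "upto_rank E 0 = {}" if chE: "Complete_Partial_Order.chain (\<le>) E" for E :: "'a set"
  proof -
    have "1 \<le> rank_in E v" if "v \<in> E" for v
      using imageI[OF that, of "rank_in E"] rank_in_image[OF chE] by auto
    then show ?thesis unfolding upto_rank_def by fastforce
  qed
  let ?P = "\<lambda>n. upto_rank C n \<noteq> upto_rank D n"
  \<comment> \<open>Past both cardinalities the truncations are the facets themselves, so a least
    rank of disagreement exists; it is positive because ranks start at 1.\<close>
  have "?P (max (card C) (card D))" using all chains \<open>C \<noteq> D\<close> by simp
  then obtain n where n: "?P n" and least: "\<And>m. m < n \<Longrightarrow> \<not> ?P m"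
    using exists_least_iff[of ?P] by blast
  obtain a where a: "n = a + 1"
    using n zero chains by (cases n) auto
  have eq: "upto_rank C a = upto_rank D a" using least a by auto
  have sub: "upto_rank E m \<subseteq> E" for E :: "'a set" and m unfolding upto_rank_def by auto
  have "a < card C"
  proof (rule ccontr)
    assume "\<not> a < card C"
    then have "C \<subseteq> D" using all[OF chains(1), of a] eq sub[of D a] by auto
    then show False using facets_subset_eq[OF C D] \<open>C \<noteq> D\<close> by auto
  qed
  then have "a + 1 \<in> rank_in C ` C" using rank_in_image[OF chains(1)] by auto
  then obtain x where x: "x \<in> C" "rank_in C x = a + 1" by (auto elim!: imageE)
  have "a < card D"
  proof (rule ccontr)
    assume "\<not> a < card D"
    then have "D \<subseteq> C" using all[OF chains(2), of a] eq sub[of C a] by auto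
    then show False using facets_subset_eq[OF D C] \<open>C \<noteq> D\<close> by auto
  qed
  then have "a + 1 \<in> rank_in D ` D" using rank_in_image[OF chains(2)] by auto
  then obtain y where y: "y \<in> D" "rank_in D y = a + 1" by (auto elim!: imageE)
  \<comment> \<open>A chain has only one vertex of rank \<open>a + 1\<close>; if
    \<open>x = y\<close>, the two truncations would therefore still agree at
    \<open>a + 1 = n\<close>.\<close>
  have step: "upto_rank E (a + 1) = insert z (upto_rank E a)"
    if "Complete_Partial_Order.chain (\<le>) E" "z \<in> E" "rank_in E z = a + 1" for E :: "'a set" and z
    using inj_on_rank_in[OF that(1)] that(2,3)
    unfolding upto_rank_def inj_on_def by (auto simp: le_Suc_eq)
  have "x \<noteq> y" using n a eq step[OF chains(1) x] step[OF chains(2) y] by auto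
  with that eq x y show thesis by blast
qed

section \<open>Convexity of the minimal skipped sets\<close>

text \<open>Convexity is relative to \<open>C\<close>: for a chain \<open>C\<close> it says that \<open>A\<close> occupies consecutive ranks.\<close>

definition convex_in :: "'a::order set \<Rightarrow> 'a set \<Rightarrow> bool" where
  "convex_in C A \<longleftrightarrow> A \<subseteq> C \<and> (\<forall>u\<in>A. \<forall>v\<in>A. \<forall>w\<in>C. u < w \<and> w < v \<longrightarrow> w \<in> A)"

text \<open>The invariant of the recursion that builds J. Incomparability is included because a set
  contained in the first interval would be truncated to the empty set.\<close>

definition interval_antichain :: "'a::order set \<Rightarrow> 'a set set \<Rightarrow> bool" where
  "interval_antichain C I \<longleftrightarrow>
     (\<forall>A\<in>I. A \<noteq> {} \<and> convex_in C A) \<and> (\<forall>A\<in>I. \<forall>B\<in>I. \<not> A \<subset> B)"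

lemma interval_antichainD:
  assumes "interval_antichain C I" "A \<in> I"
  shows "A \<noteq> {}" "convex_in C A" "A \<subseteq> C"
proof -
  show "A \<noteq> {}" and convex: "convex_in C A"
    using assms unfolding interval_antichain_def by fast+
  show "A \<subseteq> C" using convex unfolding convex_in_def by (rule conjunct1)
qed

text \<open>The vertex \<open>u\<close> shows that \<open>F i\<close> and \<open>F k\<close> already
  differ at some rank reached before \<open>w\<close>. The spliced facet keeps \<open>F i\<close> up
  to \<open>w\<close>, hence through that first difference, and so inherits the precedence of
  \<open>F i\<close> over \<open>F k\<close>.\<close>

lemma lexicographic_order_splice:
  fixes F :: "nat \<Rightarrow> 'a::{finite, order_bot, order_top} set"
  assumes lex: "lexicographic_order F N"
    and ik: "i \<in> {1..N}" "k \<in> {1..N}" "i < k"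
    and u: "u \<in> F k" "u \<notin> F i" and w: "w \<in> F i" "w \<in> F k" and "u < w"
  obtains m where "m \<in> {1..<k}" "F m = {z \<in> F i. z \<le> w} \<union> {z \<in> F k. w \<le> z}"
proof -
  have bij: "bij_betw F {1..N} facets" using lex unfolding lexicographic_order_def by blast
  then have facet: "F l \<in> facets" if "l \<in> {1..N}" for l
    using that by (auto simp: bij_betw_def)
  note Fi = facet[OF ik(1)] and Fk = facet[OF ik(2)]
  have "F i \<noteq> F k" using u by blast
  from facets_first_difference[OF Fi Fk this] obtain a x y where
    a: "upto_rank (F i) a = upto_rank (F k) a" "x \<in> F i" "y \<in> F k"
      "rank_in (F i) x = a + 1" "rank_in (F k) y = a + 1" "x \<noteq> y" .
  let ?E = "{z \<in> F i. z \<le> w} \<union> {z \<in> F k. w \<le> z}"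
  have "?E \<in> facets" by (rule facets_splice[OF Fi Fk w])
  then have "?E \<in> F ` {1..N}" using bij unfolding bij_betw_def by simp
  then obtain m where m: "m \<in> {1..N}" "F m = ?E" by (elim imageE) simp
  have "u \<notin> upto_rank (F k) a" using u(2) a(1) unfolding upto_rank_def by blast
  then have "a < rank_in (F k) u" using u(1) unfolding upto_rank_def by auto
  also have "\<dots> < rank_in (F k) w" by (rule rank_in_strict_mono[OF w(2) \<open>u < w\<close>])
  finally have "w \<notin> upto_rank (F k) a" unfolding upto_rank_def by auto
  \<comment> \<open>The rank of \<open>w\<close> may differ in the two facets; the common truncation
    carries the bound \<open>a < rank\<close> over from \<open>F k\<close> to
    \<open>F i\<close>.\<close>
  then have "w \<notin> upto_rank (F i) a" unfolding a(1) .
  then have "a + 1 \<le> rank_in (F i) w" using w(1) unfolding upto_rank_def by auto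
  then have "z \<le> w" if "z \<in> F i" "rank_in (F i) z \<le> a + 1" for z
    using rank_in_le_iff[OF facetsD(2)[OF Fi] that(1) w(1)] that(2) by linarith
  then have "upto_rank (F i) (a + 1) \<subseteq> F m"
    unfolding m(2) upto_rank_def by blast
  moreover have "upto_rank (F k) (a + 1) \<subseteq> F k" unfolding upto_rank_def by auto
  ultimately have "m < k"
    using lex ik a m(1) unfolding lexicographic_order_def by blast
  with m that show thesis by auto
qed

text \<open>Complements reverse inclusion, so maximal old faces give incomparable sets; these are
  nonempty because the facet \<open>F k\<close> lies in no earlier facet. Convexity comes from
  splicing.\<close>

lemma interval_antichain_skipped_intervals:
  fixes F :: "nat \<Rightarrow> 'a::{finite, order_bot, order_top} set"
  assumes lex: "lexicographic_order F N" and k: "k \<in> {1..N}"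
  shows "interval_antichain (F k) (skipped_intervals F k)"
proof -
  have bij: "bij_betw F {1..N} facets" using lex unfolding lexicographic_order_def by blast
  have nonempty: "F k - g \<noteq> {}" if g: "g \<in> old_faces F k" for g
  proof
    assume "F k - g = {}"
    with g obtain i where i: "i \<in> {1..<k}" "F k \<subseteq> F i" unfolding old_faces_def by blast
    have iN: "i \<in> {1..N}" using i k by auto
    then have "F k \<in> facets" "F i \<in> facets" using bij k by (auto simp: bij_betw_def)
    then have "F k = F i" using facets_subset_eq i by blast
    then have "k = i" using inj_onD[OF bij_betw_imp_inj_on[OF bij]] k iN by blast
    then show False using i by simp
  qed
  have convex: "convex_in (F k) (F k - g)"
    if g: "g \<in> old_faces F k" and max: "\<not> (\<exists>g'\<in>old_faces F k. g \<subset> g')" for g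
    unfolding convex_in_def
  proof (intro conjI ballI impI)
    fix u v w assume uvw: "u \<in> F k - g" "v \<in> F k - g" "w \<in> F k" "u < w \<and> w < v"
    from g obtain i where i: "i \<in> {1..<k}" "g \<subseteq> F i" "g \<subseteq> F k" unfolding old_faces_def by blast
    \<comment> \<open>The whole intersection is an old face containing \<open>g\<close>, so
      maximality of \<open>g\<close> forces equality. In particular the deleted vertex
      \<open>u\<close> is not in \<open>F i\<close>, as splicing requires.\<close>
    then have "F i \<inter> F k \<in> old_faces F k" unfolding old_faces_def by blast
    with max have "\<not> g \<subset> F i \<inter> F k" by blast
    with i(2,3) have geq: "g = F i \<inter> F k" by (simp add: psubset_eq)
    show "w \<in> F k - g"
    proof (rule ccontr)
      assume "w \<notin> F k - g"
      then have w: "w \<in> g" using uvw by blast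
      obtain m where m: "m \<in> {1..<k}" "F m = {z \<in> F i. z \<le> w} \<union> {z \<in> F k. w \<le> z}"
        using lexicographic_order_splice[OF lex, of i k u w] i k uvw w geq by auto
      \<comment> \<open>This old face retains all of \<open>g\<close>, on either side of
        \<open>w\<close>, and gains the deleted vertex \<open>v\<close> above \<open>w\<close>,
        against the maximality of \<open>g\<close>.\<close>
      then have old: "F m \<inter> F k \<in> old_faces F k" unfolding old_faces_def by blast
      have "v \<in> F m \<inter> F k" unfolding m(2) using uvw(2,4) order_less_imp_le by blast
      moreover have "g \<subseteq> F m \<inter> F k"
      proof
        fix z assume "z \<in> g"
        have "F k \<in> facets" using bij k by (auto simp: bij_betw_def)
        from chainD[OF facetsD(2)[OF this], of z w]
        show "z \<in> F m \<inter> F k" using \<open>z \<in> g\<close> uvw(3) geq m(2) by auto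
      qed
      ultimately show False using max old uvw by blast
    qed
  qed auto
  have incomparable: "\<not> F k - g \<subset> F k - g'"
    if "g \<in> old_faces F k" "\<not> (\<exists>h\<in>old_faces F k. g' \<subset> h)" "g' \<in> old_faces F k" for g g'
  proof
    assume "F k - g \<subset> F k - g'"
    moreover have "g \<subseteq> F k" "g' \<subseteq> F k" using that unfolding old_faces_def by auto
    ultimately have "g' \<subset> g" by blast
    with that show False by blast
  qed
  show ?thesis
    unfolding interval_antichain_def
  proof (intro conjI ballI)
    fix A assume "A \<in> skipped_intervals F k"
    then obtain g where g: "A = F k - g" "g \<in> old_faces F k" "\<not> (\<exists>g'\<in>old_faces F k. g \<subset> g')"
      unfolding skipped_intervals_def by auto
    show "A \<noteq> {}" unfolding g(1) by (rule nonempty[OF g(2)])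
    show "convex_in (F k) A" unfolding g(1) by (rule convex[OF g(2,3)])
    fix B assume "B \<in> skipped_intervals F k"
    then obtain g' where g': "B = F k - g'" "g' \<in> old_faces F k" "\<not> (\<exists>h\<in>old_faces F k. g' \<subset> h)"
      unfolding skipped_intervals_def by auto
    show "\<not> A \<subset> B" unfolding g(1) g'(1) by (rule incomparable[OF g(2) g'(3,2)])
  qed
qed

section \<open>The truncation step and disjointness of the resulting intervals\<close>

lemma truncate_above_subset: "truncate_above C j A \<subseteq> A"
  unfolding truncate_above_def by blast

lemma convex_in_truncate_above:
  fixes C :: "'a::{finite, order} set"
  assumes "convex_in C A"
  shows "convex_in C (truncate_above C j A)"
  unfolding convex_in_def
proof (intro conjI ballI impI)
  show "truncate_above C j A \<subseteq> C"
    using assms truncate_above_subset unfolding convex_in_def by blast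
next
  fix u v w assume h: "u \<in> truncate_above C j A" "v \<in> truncate_above C j A" "w \<in> C" "u < w \<and> w < v"
  then have "w \<in> A" using assms truncate_above_subset unfolding convex_in_def by blast
  moreover have "rank_in C u < rank_in C w" using rank_in_strict_mono h by blast
  ultimately show "w \<in> truncate_above C j A"
    using h(1) unfolding truncate_above_def by auto
qed

text \<open>If nothing of \<open>A\<close> survived, each vertex of \<open>A\<close> would lie
  weakly below some vertex of \<open>?j\<close>, and weakly above the lowest vertex of
  \<open>?j\<close> since that interval starts first. Convexity then puts \<open>A\<close> inside
  \<open>?j\<close>, contradicting incomparability.\<close>

lemma truncate_above_first_interval_nonempty:
  fixes C :: "'a::{finite, order} set"
  assumes chain: "Complete_Partial_Order.chain (\<le>) C" and I: "interval_antichain C I"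
    and A: "A \<in> I" "A \<noteq> first_interval C I"
  shows "truncate_above C (first_interval C I) A \<noteq> {}"
proof
  let ?j = "first_interval C I"
  assume empty: "truncate_above C ?j A = {}"
  have j: "?j \<in> I" using A first_interval_in by blast
  have cj: "convex_in C ?j" "?j \<noteq> {}" and cA: "convex_in C A"
    using interval_antichainD[OF I] j A by blast+
  have "A \<subseteq> ?j"
  proof
    fix v assume v: "v \<in> A"
    then obtain u where u: "u \<in> ?j" "rank_in C v \<le> rank_in C u"
      using empty unfolding truncate_above_def by fastforce
    let ?l = "lowest C ?j"
    have l: "?l \<in> ?j" using lowest_in cj by blast
    have "?j \<subseteq> C" "A \<subseteq> C" using interval_antichainD(3)[OF I] j A by blast+
    then have sub: "v \<in> C" "u \<in> C" "?l \<in> C" using v u(1) l by auto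
    have "rank_in C ?l \<le> rank_in C v"
      using lowest_rank_first_interval_le[OF A(1), of C] lowest_rank_le[OF v, of C]
      unfolding lowest_rank_def by linarith
    then have "?l \<le> v" using rank_in_le_iff[OF chain sub(3,1)] by simp
    moreover have "v \<le> u" using rank_in_le_iff[OF chain sub(1,2)] u(2) by simp
    ultimately consider "v = ?l" | "v = u" | "?l < v" "v < u" by (auto simp: order_le_less)
    then show "v \<in> ?j"
      using cj(1) l u(1) sub(1) unfolding convex_in_def by cases blast+
  qed
  with A have "A \<subset> ?j" by blast
  with I A j show False unfolding interval_antichain_def by blast
qed

text \<open>Truncation preserves nonemptiness and convexity; passing to \<open>minimal_sets\<close>
  restores the incomparability that truncation can destroy.\<close>

lemma interval_antichain_step:
  fixes C :: "'a::{finite, order} set"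
  assumes "Complete_Partial_Order.chain (\<le>) C" "interval_antichain C I"
  defines "j \<equiv> first_interval C I"
  shows "interval_antichain C (minimal_sets (truncate_above C j ` (I - {j})))"
proof -
  have "truncate_above C j A \<noteq> {} \<and> convex_in C (truncate_above C j A)" if "A \<in> I - {j}" for A
  proof
    show "truncate_above C j A \<noteq> {}"
      using that truncate_above_first_interval_nonempty[OF assms(1,2)] unfolding j_def by simp
    show "convex_in C (truncate_above C j A)"
      using that interval_antichainD(2)[OF assms(2)] by (simp add: convex_in_truncate_above)
  qed
  then show ?thesis unfolding interval_antichain_def minimal_sets_def by blast
qed

text \<open>The containment in members of \<open>I\<close> strengthens the induction: applied to the
  recursive call, it places every later interval inside a set truncated above \<open>j\<close>,
  hence off \<open>j\<close>.\<close>

lemma disjoint_intervals_disjoint: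
  fixes C :: "'a::{finite, order} set"
  assumes "Complete_Partial_Order.chain (\<le>) C" "interval_antichain C I"
  shows "{} \<notin> disjoint_intervals C I \<and> (\<forall>A\<in>disjoint_intervals C I. \<exists>B\<in>I. A \<subseteq> B) \<and>
    pairwise disjnt (disjoint_intervals C I)"
  using assms
proof (induction C I rule: disjoint_intervals.induct)
  case (1 C I)
  show ?case
  proof (cases "I = {}")
    case True
    then show ?thesis by (simp add: disjoint_intervals.simps[of C "{}"] pairwise_def)
  next
    case False
    define j where "j = first_interval C I"
    define D where "D = disjoint_intervals C (minimal_sets (truncate_above C j ` (I - {j})))"
    have eq: "disjoint_intervals C I = insert j D"
      using False unfolding D_def j_def by (subst disjoint_intervals.simps) (simp add: Let_def)
    have IH: "{} \<notin> D" "pairwise disjnt D"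
      "\<forall>A\<in>D. \<exists>B\<in>minimal_sets (truncate_above C j ` (I - {j})). A \<subseteq> B"
      using "1.IH"[OF False j_def "1.prems"(1)] interval_antichain_step[OF "1.prems"]
      unfolding D_def j_def by blast+
    have j: "j \<in> I" "j \<noteq> {}"
      using first_interval_in[OF False] "1.prems"(2)
      unfolding j_def interval_antichain_def by blast+
    have above: "\<exists>B\<in>I. A \<subseteq> truncate_above C j B" if "A \<in> D" for A
      using that IH(3) unfolding minimal_sets_def by blast
    \<comment> \<open>A common vertex would have rank strictly below its own.\<close>
    have "A \<inter> j = {}" if "A \<in> D" for A
      using above[OF that] unfolding truncate_above_def by fastforce
    then have "pairwise disjnt (insert j D)"
      using IH(2) unfolding pairwise_def disjnt_def by blast
    moreover have "\<exists>B\<in>I. A \<subseteq> B" if A: "A \<in> insert j D" for A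
    proof (cases "A = j")
      case False
      then obtain B where "B \<in> I" "A \<subseteq> truncate_above C j B" using A above by blast
      moreover from this(2) have "A \<subseteq> B" by (rule subset_trans[OF _ truncate_above_subset])
      ultimately show ?thesis by blast
    qed (use j in auto)
    moreover have "{} \<notin> insert j D" using IH(1) j by simp
    ultimately show ?thesis unfolding eq by simp
  qed
qed

section \<open>Unmatched faces and the count of their vertices\<close>

lemma (in linorder) sorted_key_list_of_set_enum:
  assumes "inj_on f A" "finite A"
  shows "set (sorted_key_list_of_set f A) = A" "length (sorted_key_list_of_set f A) = card A"
proof -
  \<comment> \<open>Insertions of elements with equal keys need not commute, hence the injectivity
    on \<open>A\<close> that the locale demands.\<close>
  interpret folding_insort_key "(\<le>)" "(<)" A f
    using assms(1) by unfold_locales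
  show "set (sorted_key_list_of_set f A) = A" "length (sorted_key_list_of_set f A) = card A"
    using assms(2) by simp_all
qed

lemma tau_infinity_iff:
  "tau F k h = \<infinity> \<longleftrightarrow> (\<forall>i\<in>{1..card (J_intervals F k)}. h \<inter> J_nth F k i = {rho F k i})"
  unfolding tau_def Let_def by auto

text \<open>Each way of violating the conclusion yields a pair containing \<open>h\<close>: case (i)
  of the matching pairs every new face, and case (ii) pairs \<open>h\<close> when \<open>tau\<close>
  is finite or when a vertex outside J remains.\<close>

lemma unmatchedD:
  assumes h: "h \<in> new_faces F k" "h \<notin> \<Union> (matching_at F k)"
  shows "F k \<subseteq> \<Union> (J_intervals F k)" "tau F k h = \<infinity>"
proof -
  let ?U = "F k - \<Union> (skipped_intervals F k)"
  let ?V = "F k - \<Union> (J_intervals F k)"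
  have U: "?U = {}"
  proof (rule ccontr)
    assume ne: "?U \<noteq> {}"
    let ?r = "lowest (F k) ?U"
    have r: "?r \<in> F k" using DiffD1[OF lowest_in[OF ne]] .
    \<comment> \<open>Enlarging a new face inside \<open>F k\<close> keeps it new, so the pair at
      \<open>?r\<close> exists and contains \<open>h\<close> whether or not \<open>?r\<close> is in
      \<open>h\<close>.\<close>
    have "insert ?r h \<in> new_faces F k" using h(1) r unfolding new_faces_def by blast
    moreover have "h = insert ?r h \<or> h = insert ?r h - {?r}" by blast
    moreover have "{insert ?r h - {?r}, insert ?r h} \<in> matching_at F k"
      using ne calculation(1) unfolding matching_at_def Let_def if_P[OF ne] by blast
    ultimately show False using h(2) by blast
  qed
  have m: "matching_at F k = {{h, toggle (rho F k i) h} | h i. h \<in> new_faces F k \<and> tau F k h = enat i} \<union>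
      {{h, toggle (lowest (F k) ?V) h} | h. h \<in> new_faces F k \<and> tau F k h = \<infinity> \<and> ?V \<noteq> {}}"
    unfolding matching_at_def Let_def using U by (simp only: if_False simp_thms)
  show "tau F k h = \<infinity>"
  proof (cases "tau F k h")
    case (enat i)
    then have "{h, toggle (rho F k i) h} \<in> matching_at F k" unfolding m using h(1) by blast
    then show ?thesis using h(2) by blast
  qed
  then have "?V = {}"
    using h unfolding m by blast
  then show "F k \<subseteq> \<Union> (J_intervals F k)" by blast
qed

theorem corollary2p1:
  fixes F :: "nat \<Rightarrow> 'a::{finite, order_bot, order_top} set"
    and N k :: nat
    and \<sigma> :: "'a set"
  assumes "lexicographic_order F N"
    and "k \<in> {1..N}"
    and "\<sigma> \<in> new_faces F k"
    and "critical_cell F N \<sigma>"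
  shows "face_dim \<sigma> = int (card (J_intervals F k)) - 1"
proof -
  let ?J = "J_intervals F k"
  have "F k \<in> facets"
    using assms(1,2) unfolding lexicographic_order_def bij_betw_def by blast
  then have chain: "Complete_Partial_Order.chain (\<le>) (F k)" by (rule facetsD)
  note ia = interval_antichain_skipped_intervals[OF assms(1,2)]
  note di = disjoint_intervals_disjoint[OF chain ia, folded J_intervals_def]
  have low: "lowest (F k) A \<in> A" "A \<subseteq> F k" if "A \<in> ?J" for A
  proof -
    from that di have "A \<noteq> {}" by blast
    then show "lowest (F k) A \<in> A" by (rule lowest_in)
    from that di obtain B where "B \<in> skipped_intervals F k" "A \<subseteq> B" by blast
    then show "A \<subseteq> F k" using interval_antichainD(3)[OF ia] by blast
  qed
  have inj: "inj_on (lowest (F k)) ?J"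
    using low di unfolding inj_on_def pairwise_def disjnt_def by (metis IntI emptyE)
  \<comment> \<open>Distinct lowest vertices have distinct ranks in the chain; with this key
    \<open>J_nth\<close> runs through all of \<open>?J\<close>.\<close>
  then have "inj_on (lowest_rank (F k)) ?J"
    using low inj_on_rank_in[OF chain] unfolding inj_on_def lowest_rank_def by (metis subsetD)
  note enum = sorted_key_list_of_set_enum[OF this finite]
  have "\<sigma> \<notin> \<Union> (matching_at F k)"
    using assms(2,4) unfolding critical_cell_def matching_def by blast
  note um = unmatchedD[OF assms(3) this]
  have meet: "\<sigma> \<inter> A = {lowest (F k) A}" if A: "A \<in> ?J" for A
  proof -
    \<comment> \<open>List positions start at 0 and the indices of \<open>J_nth\<close> at 1, hence
      the shift.\<close>
    from A enum obtain i where "i < card ?J" "A = J_nth F k (i + 1)"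
      unfolding J_nth_def by (metis add_diff_cancel_right' in_set_conv_nth)
    then show ?thesis using um(2) unfolding tau_infinity_iff rho_def by auto
  qed
  have "\<sigma> \<subseteq> F k" using assms(3) unfolding new_faces_def by blast
  \<comment> \<open>J covers \<open>F k\<close>, so \<sigma> is the union of its one-vertex
    intersections with the intervals.\<close>
  then have "\<sigma> = lowest (F k) ` ?J" using um(1) meet by blast
  then have "card \<sigma> = card ?J" using card_image[OF inj] by simp
  then show ?thesis unfolding face_dim_def by simp
qed

end
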